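(* For every $n\ge0$, in $\mathbf{sNSym}$, $$\tilde S_n=\sum_{k=0}^n(-1)^{n-k}\Psi_{n-k}S_k.$$
   Context: $\mathbf{sNSym}$, as an algebra, is the free associative unital $\mathbb Q$-algebra on generators $H_n$ ($n\ge1$) and $\tilde H_n$ ($n\ge0$), with $H_0=1$. The elements $\Psi_n$ are defined by $\Psi_0=\tilde H_0$ and $\Psi_n=\tilde H_n-\sum_{k=0}^{n-1}H_{n-k}\Psi_k$ for $n\ge1$. The noncommutative elementary functions in superspace $S_n,\tilde S_n$ are defined by the generating function identity $\sigma(t,\tau)\lambda(-t,-\tau)=1$, where $\lambda(t,\tau)=\sum_{n\ge0}t^n(H_n+\tau\tilde H_n)$, $\sigma(t,\tau)=\sum_{n\ge0}t^n(S_n+\tau\tilde S_n)$ and $\tau^2=0$. Explicitly: $S_0=1$, $\sum_{k=0}^n(-1)^{n-k}S_kH_{n-k}=0$ for $n\ge1$, and $\sum_{k=0}^n(-1)^{n-k}(S_k\tilde H_{n-k}-\tilde S_kH_{n-k})=0$ for $n\ge0$. *)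

theory Defs
  imports Complex_Main "HOL-Library.Poly_Mapping"
begin

text \<open>
  Words under concatenation, written additively because the convolution product on
  \<^typ>\<open>'a \<Rightarrow>\<^sub>0 'b\<close> multiplies basis elements through \<open>+\<close> on exponents. A wrapper around
  lists is used since \<open>+\<close> on lists has a pointwise meaning elsewhere in the library.
\<close>

datatype 'a free_monoid = Word "'a list"

instantiation free_monoid :: (type) monoid_add
begin

definition zero_free_monoid :: "'a free_monoid" where
  "0 = Word []"

fun plus_free_monoid :: "'a free_monoid \<Rightarrow> 'a free_monoid \<Rightarrow> 'a free_monoid" where
  "Word u + Word v = Word (u @ v)"

instance
proof
  fix a b c :: "'a free_monoid"
  show "a + b + c = a + (b + c)"
    by (cases a; cases b; cases c) simp
  show "0 + a = a"
    by (cases a) (simp add: zero_free_monoid_def)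
  show "a + 0 = a"
    by (cases a) (simp add: zero_free_monoid_def)
qed

end

text \<open>
  \<open>Gen_H n\<close> stands for the generator $H_{n+1}$ (there is no generator $H_0$), and
  \<open>Gen_Ht n\<close> for $\tilde H_n$.
\<close>

datatype gen = Gen_H nat | Gen_Ht nat

text \<open>
  The free associative unital algebra over the rationals, as the monoid algebra of the
  free monoid. The rational \<open>q\<close> is embedded as \<open>Poly_Mapping.single 0 q\<close>.
\<close>

type_synonym sNSym = "gen free_monoid \<Rightarrow>\<^sub>0 rat"

definition gen :: "gen \<Rightarrow> sNSym" where
  "gen g = Poly_Mapping.single (Word [g]) 1"

definition H :: "nat \<Rightarrow> sNSym" where
  "H n = (case n of 0 \<Rightarrow> 1 | Suc m \<Rightarrow> gen (Gen_H m))"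

definition Ht :: "nat \<Rightarrow> sNSym" where
  "Ht n = gen (Gen_Ht n)"

fun Psi :: "nat \<Rightarrow> sNSym" where
  "Psi n = Ht n - (\<Sum>k<n. H (n - k) * Psi k)"

text \<open>
  The following two recursions are the relations defining $S_n$ and $\tilde S_n$, i.e. the
  coefficients of $\sigma(t,\tau)\lambda(-t,-\tau) = 1$, solved for the term with $k = n$.
  The relations themselves, and the fact that they determine $S$ and $\tilde S$, are proved
  below.
\<close>

fun S :: "nat \<Rightarrow> sNSym" where
  "S n = (if n = 0 then 1 else - (\<Sum>k<n. (-1) ^ (n - k) * S k * H (n - k)))"

fun St :: "nat \<Rightarrow> sNSym" where
  "St n = (\<Sum>k\<le>n. (-1) ^ (n - k) * S k * Ht (n - k))
        - (\<Sum>k<n. (-1) ^ (n - k) * St k * H (n - k))"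

declare Psi.simps [simp del] S.simps [simp del] St.simps [simp del]

lemma Psi_0: "Psi 0 = Ht 0"
  by (simp add: Psi.simps [of 0])

lemma S_0: "S 0 = 1"
  by (simp add: S.simps [of 0])

lemma H_0: "H 0 = 1"
  by (simp add: H_def)

lemma sum_atMost_split: "(\<Sum>k\<le>n. f k) = f n + (\<Sum>k<n. f k)"
  for f :: "nat \<Rightarrow> 'a::comm_monoid_add"
  by (simp add: add.commute flip: lessThan_Suc_atMost)

lemma S_relation:
  assumes "n \<ge> 1"
  shows "(\<Sum>k\<le>n. (-1) ^ (n - k) * S k * H (n - k)) = 0"
  using assms S.simps [of n] by (simp add: sum_atMost_split H_0)

lemma St_relation:
  "(\<Sum>k\<le>n. (-1) ^ (n - k) * (S k * Ht (n - k) - St k * H (n - k))) = 0"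
proof -
  have "(\<Sum>k\<le>n. (-1) ^ (n - k) * St k * H (n - k))
      = (\<Sum>k\<le>n. (-1) ^ (n - k) * S k * Ht (n - k))"
    using St.simps [of n] by (simp add: sum_atMost_split H_0 algebra_simps)
  then show ?thesis
    by (simp add: right_diff_distrib sum_subtractf mult.assoc)
qed

lemma S_unique:
  assumes "S' 0 = 1"
    and "\<And>n. n \<ge> 1 \<Longrightarrow> (\<Sum>k\<le>n. (-1) ^ (n - k) * S' k * H (n - k)) = 0"
  shows "S' = S"
proof
  fix n
  show "S' n = S n"
  proof (induction n rule: less_induct)
    case (less n)
    show ?case
    proof (cases "n = 0")
      case True
      then show ?thesis by (simp add: assms(1) S_0)
    next
      case False
      have "S' n + (\<Sum>k<n. (-1) ^ (n - k) * S' k * H (n - k)) = 0"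
        using assms(2) [of n] False by (simp add: sum_atMost_split H_0)
      moreover have "S n + (\<Sum>k<n. (-1) ^ (n - k) * S k * H (n - k)) = 0"
        using S_relation [of n] False by (simp add: sum_atMost_split H_0)
      moreover have "(\<Sum>k<n. (-1) ^ (n - k) * S' k * H (n - k))
          = (\<Sum>k<n. (-1) ^ (n - k) * S k * H (n - k))"
        by (intro sum.cong) (simp_all add: less.IH)
      ultimately show ?thesis by (simp add: eq_neg_iff_add_eq_0 [symmetric])
    qed
  qed
qed

lemma St_unique:
  assumes "\<And>n. (\<Sum>k\<le>n. (-1) ^ (n - k) * (S k * Ht (n - k) - St' k * H (n - k))) = 0"
  shows "St' = St"
proof
  fix n
  show "St' n = St n"
  proof (induction n rule: less_induct)
    case (less n)
    let ?T = "\<lambda>X k. (-1) ^ (n - k) * (S k * Ht (n - k) - X k * H (n - k))"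
    have "(S n * Ht 0 - St' n) + sum (?T St') {..<n} = 0"
      using assms [of n] by (simp add: sum_atMost_split H_0)
    moreover have "(S n * Ht 0 - St n) + sum (?T St) {..<n} = 0"
      using St_relation [of n] by (simp add: sum_atMost_split H_0)
    moreover have "sum (?T St') {..<n} = sum (?T St) {..<n}"
      by (intro sum.cong) (simp_all add: less.IH)
    ultimately have "S n * Ht 0 - St' n = S n * Ht 0 - St n"
      unfolding eq_neg_iff_add_eq_0 [symmetric] by (simp only:)
    then show ?case by simp
  qed
qed

end

theory Submission
  imports Defs "HOL-Computational_Algebra.Formal_Power_Series"
begin

text \<open>
  Write $H(t)$, $\tilde H(t)$, $\Psi(t)$, $S(t)$, $\tilde S(t)$ for the ordinary generating
  functions, with coefficients in the noncommutative algebra \<^typ>\<open>sNSym\<close> and $t$ central.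
  The definitions become $H(t)\Psi(t) = \tilde H(t)$, $S(t)H(-t) = 1$ and
  $\tilde S(t)H(-t) = S(t)\tilde H(-t)$, and the claim becomes $\tilde S(t) = \Psi(-t)S(t)$.
  Since $\tilde S$ is the only solution of the third identity, it is enough that
  $\Psi(-t)S(t)$ also solves it, and indeed both sides reduce to $\Psi(-t)$:
  $$\Psi(-t)\,S(t)H(-t) = \Psi(-t) = S(t)H(-t)\,\Psi(-t) = S(t)\tilde H(-t).$$
  Both reductions cancel $S(t)H(-t)$, the order of the factors in which the definition of $S$
  gives the product.
\<close>

text \<open>
  The substitution $t \mapsto -t$.
\<close>

definition fps_reflect :: "'a::ring_1 fps \<Rightarrow> 'a fps" where
  "fps_reflect F = Abs_fps (\<lambda>n. (-1) ^ n * fps_nth F n)"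

lemma fps_reflect_nth [simp]: "fps_nth (fps_reflect F) n = (-1) ^ n * fps_nth F n"
  by (simp add: fps_reflect_def)

lemma mult_minus_one_power_left_commute:
  "a * ((-1) ^ n * b) = (-1) ^ n * (a * b)" for a b :: "'a::ring_1"
  by (cases "even n") simp_all

text \<open>
  Multiplicativity survives noncommutativity of the coefficients because the signs are central.
\<close>

lemma fps_reflect_mult: "fps_reflect (F * G) = fps_reflect F * fps_reflect G"
proof (rule fps_ext)
  fix n
  have "(-1) ^ n * (fps_nth F i * fps_nth G (n - i))
      = ((-1) ^ i * fps_nth F i) * ((-1) ^ (n - i) * fps_nth G (n - i))" if "i \<le> n" for i
  proof -
    have "(-1) ^ n * (fps_nth F i * fps_nth G (n - i))
        = (-1) ^ i * ((-1) ^ (n - i) * (fps_nth F i * fps_nth G (n - i)))"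
      using that by (simp flip: power_add mult.assoc)
    also have "\<dots> = (-1) ^ i * (fps_nth F i * ((-1) ^ (n - i) * fps_nth G (n - i)))"
      by (simp only: mult_minus_one_power_left_commute [of "fps_nth F i"])
    finally show ?thesis
      by (simp only: mult.assoc)
  qed
  then show "fps_nth (fps_reflect (F * G)) n = fps_nth (fps_reflect F * fps_reflect G) n"
    by (simp add: fps_mult_nth sum_distrib_left)
qed

text \<open>
  Moving the sign to the front gives the form in which the relations for $S$ and $\tilde S$
  are stated.
\<close>

lemma fps_mult_reflect_nth:
  "fps_nth (F * fps_reflect G) n
    = (\<Sum>k\<le>n. (-1) ^ (n - k) * (fps_nth F k * fps_nth G (n - k)))"
  by (simp add: fps_mult_nth atLeast0AtMost mult_minus_one_power_left_commute [of "fps_nth F _"])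

lemma H_mult_Psi: "Abs_fps H * Abs_fps Psi = Abs_fps Ht"
proof (rule fps_ext)
  fix n
  have "fps_nth (Abs_fps H * Abs_fps Psi) n = (\<Sum>k\<le>n. H (n - k) * Psi k)"
    unfolding fps_mult_nth atLeast0AtMost
    by (subst sum.nat_diff_reindex [symmetric, of _ "Suc n", unfolded lessThan_Suc_atMost])
      (auto intro!: sum.cong)
  also have "\<dots> = Ht n"
    using Psi.simps [of n] by (simp add: sum_atMost_split H_0)
  finally show "fps_nth (Abs_fps H * Abs_fps Psi) n = fps_nth (Abs_fps Ht) n"
    by simp
qed

lemma S_mult_reflect_H: "Abs_fps S * fps_reflect (Abs_fps H) = 1"
proof (rule fps_ext)
  fix n
  show "fps_nth (Abs_fps S * fps_reflect (Abs_fps H)) n = fps_nth 1 n"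
    using S_relation [of n]
    by (cases "n = 0") (simp_all add: fps_mult_reflect_nth S_0 H_0 mult.assoc)
qed

theorem proposition5p3:
  fixes n :: nat
  shows "St n = (\<Sum>k\<le>n. (-1) ^ (n - k) * Psi (n - k) * S k)"
proof -
  define P where "P = fps_reflect (Abs_fps Psi) * Abs_fps S"
  have "Abs_fps S * fps_reflect (Abs_fps Ht) = P * fps_reflect (Abs_fps H)"
  proof -
    have "Abs_fps S * fps_reflect (Abs_fps Ht)
        = (Abs_fps S * fps_reflect (Abs_fps H)) * fps_reflect (Abs_fps Psi)"
      by (simp add: fps_reflect_mult mult.assoc flip: H_mult_Psi)
    also have "\<dots> = P * fps_reflect (Abs_fps H)"
      by (simp add: P_def S_mult_reflect_H mult.assoc)
    finally show ?thesis .
  qed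
  then have "(\<Sum>k\<le>m. (-1) ^ (m - k) * (S k * Ht (m - k) - fps_nth P k * H (m - k))) = 0" for m
    by (simp add: fps_eq_iff fps_mult_reflect_nth right_diff_distrib sum_subtractf)
  then have "fps_nth P = St"
    by (rule St_unique)
  then have "St n = (\<Sum>k\<le>n. (-1) ^ k * Psi k * S (n - k))"
    by (simp add: P_def fps_mult_nth atLeast0AtMost flip: \<open>fps_nth P = St\<close>)
  also have "\<dots> = (\<Sum>k\<le>n. (-1) ^ (n - k) * Psi (n - k) * S k)"
    by (subst sum.nat_diff_reindex [symmetric, of _ "Suc n", unfolded lessThan_Suc_atMost])
      (auto intro!: sum.cong)
  finally show ?thesis .
qed

end
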